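(* Let $d,k,j\ge1$. Suppose there is no $\mathfrak W_k$-equivariant map $Y_{d,k}\to S(U_k^{\oplus j})$. Then $\Delta(j-m,k)\le d-m$ for all $m\in\{0,\dots,j-1\}$.
   Context: A mass on $\mathbb{R}^d$ is a finite Borel probability measure vanishing on every affine hyperplane. $\Delta(j,k)$ is the smallest $d$ such that every collection of $j$ masses on $\mathbb{R}^d$ can be equiparted by $k$ affine hyperplanes (each of the $2^k$ orthants, i.e. intersections of one chosen closed side of each hyperplane, has measure $2^{-k}$ in each mass). $Y_{d,k}=(S^d)^k$ with $\mathfrak W_k=(\mathbb{Z}/2)^k\rtimes\mathfrak S_k$ acting by $((\beta_1,\dots,\beta_k)\rtimes\tau)\cdot(v_1,\dots,v_k)=((-1)^{\beta_1}v_{\tau^{-1}(1)},\dots,(-1)^{\beta_k}v_{\tau^{-1}(k)})$. $U_k=\{(y_\alpha)_{\alpha\in(\mathbb{Z}/2)^k}:\sum_\alpha y_\alpha=0\}$ with $\mathfrak W_k$ permuting coordinates via the index action $((\beta)\rtimes\tau)\cdot\alpha=(\beta_1+\alpha_{\tau^{-1}(1)},\dots,\beta_k+\alpha_{\tau^{-1}(k)})$ mod 2; $U_k^{\oplus j}$ has the diagonal action and $S(\cdot)$ is the unit sphere. *)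

theory Defs
  imports "HOL-Probability.Probability" "HOL-Combinatorics.Permutations"
begin

text \<open>R^n is represented by the explicit carrier PiE {..<n} UNIV with the product
  Borel sigma algebra (= Borel sets of R^n).\<close>
definition Rn :: "nat \<Rightarrow> (nat \<Rightarrow> real) measure" where
  "Rn n = PiM {..<n} (\<lambda>_. borel)"

definition mass :: "nat \<Rightarrow> (nat \<Rightarrow> real) measure \<Rightarrow> bool" where
  "mass n \<mu> \<longleftrightarrow> sets \<mu> = sets (Rn n) \<and> prob_space \<mu> \<and>
     (\<forall>(a::nat \<Rightarrow> real) (b::real). (\<exists>t<n. a t \<noteq> 0) \<longrightarrow>
        measure \<mu> {x \<in> space (Rn n). (\<Sum>t<n. a t * x t) = b} = 0)"

definition orthant :: "nat \<Rightarrow> nat \<Rightarrow> (nat \<Rightarrow> nat \<Rightarrow> real) \<Rightarrow> (nat \<Rightarrow> real) \<Rightarrow> nat set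
    \<Rightarrow> (nat \<Rightarrow> real) set" where
  "orthant n k a b \<alpha> = {x \<in> space (Rn n). \<forall>i<k.
      (if i \<in> \<alpha> then (\<Sum>t<n. a i t * x t) \<ge> b i else (\<Sum>t<n. a i t * x t) \<le> b i)}"

definition equipartitionable :: "nat \<Rightarrow> nat \<Rightarrow> nat \<Rightarrow> bool" where
  "equipartitionable j k n \<longleftrightarrow>
     (\<forall>\<mu> :: nat \<Rightarrow> (nat \<Rightarrow> real) measure. (\<forall>l<j. mass n (\<mu> l)) \<longrightarrow>
       (\<exists>a b. (\<forall>i<k. \<exists>t<n. a i t \<noteq> 0) \<and>
          (\<forall>l<j. \<forall>\<alpha>. \<alpha> \<subseteq> {..<k} \<longrightarrow> measure (\<mu> l) (orthant n k a b \<alpha>) = 1 / 2 ^ k)))"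

definition Delta :: "nat \<Rightarrow> nat \<Rightarrow> nat" where
  "Delta j k = (LEAST d. equipartitionable j k d)"

definition Yspace :: "nat \<Rightarrow> nat \<Rightarrow> (nat \<Rightarrow> nat \<Rightarrow> real) set" where
  "Yspace d k = {v. (\<forall>i<k. (\<Sum>t\<le>d. (v i t)^2) = 1 \<and> (\<forall>t>d. v i t = 0)) \<and>
                    (\<forall>i\<ge>k. \<forall>t. v i t = 0)}"

text \<open>S(U_k^{\<oplus> j}): z l alpha, l<j, alpha \<subseteq> {..<k} (an element of (Z/2)^k).\<close>
definition SU :: "nat \<Rightarrow> nat \<Rightarrow> (nat \<Rightarrow> nat set \<Rightarrow> real) set" where
  "SU k j = {z. (\<forall>l<j. (\<Sum>\<alpha>\<in>Pow {..<k}. z l \<alpha>) = 0) \<and>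
               (\<Sum>l<j. \<Sum>\<alpha>\<in>Pow {..<k}. (z l \<alpha>)^2) = 1 \<and>
               (\<forall>l \<alpha>. (j \<le> l \<or> \<not> \<alpha> \<subseteq> {..<k}) \<longrightarrow> z l \<alpha> = 0)}"

definition Wk :: "nat \<Rightarrow> (nat set \<times> (nat \<Rightarrow> nat)) set" where
  "Wk k = {(\<beta>, \<tau>). \<beta> \<subseteq> {..<k} \<and> \<tau> permutes {..<k}}"

definition actY :: "nat set \<Rightarrow> (nat \<Rightarrow> nat) \<Rightarrow> (nat \<Rightarrow> nat \<Rightarrow> real) \<Rightarrow> (nat \<Rightarrow> nat \<Rightarrow> real)" where
  "actY \<beta> \<tau> v = (\<lambda>i t. (if i \<in> \<beta> then -1 else 1) * v (inv \<tau> i) t)"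

text \<open>Index action: (g.alpha)_i = beta_i + alpha_{tau^{-1} i} mod 2.\<close>
definition actIdx :: "nat set \<Rightarrow> (nat \<Rightarrow> nat) \<Rightarrow> nat set \<Rightarrow> nat set" where
  "actIdx \<beta> \<tau> \<alpha> = {i. (i \<in> \<beta>) \<noteq> (inv \<tau> i \<in> \<alpha>)}"

text \<open>Equivariance: (g.y)_{g.alpha} = y_alpha, i.e. f(g.v)_{l, g.alpha} = f(v)_{l,alpha}.\<close>
definition equivariant :: "nat \<Rightarrow> nat \<Rightarrow> nat \<Rightarrow> ((nat \<Rightarrow> nat \<Rightarrow> real) \<Rightarrow> (nat \<Rightarrow> nat set \<Rightarrow> real)) \<Rightarrow> bool" where
  "equivariant d k j f \<longleftrightarrow>
     (\<forall>\<beta> \<tau>. (\<beta>, \<tau>) \<in> Wk k \<longrightarrow> (\<forall>v\<in>Yspace d k. \<forall>l<j. \<forall>\<alpha>\<in>Pow {..<k}.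
        f (actY \<beta> \<tau> v) l (actIdx \<beta> \<tau> \<alpha>) = f v l \<alpha>))"

end

theory Submission
  imports Defs
begin

text \<open>Suppose masses \<open>\<mu> l\<close> (\<open>l < j - m\<close>) on \<open>R^(d-m)\<close> admit no equipartition. Split each
  \<open>v i\<close> in \<open>S^d\<close> into a head in \<open>R^(d-m+1)\<close>, read as an oriented (possibly degenerate) affine
  hyperplane of \<open>R^(d-m)\<close>, and a tail in \<open>R^m\<close>. The defects of the orthant measures depend
  continuously on the heads as long as these are nonzero; multiplied by the squared lengths of all heads
  they extend continuously to the whole of \<open>Y\<close>. Each tail coordinate contributes one further copy of
  \<open>U\<close> through the equivariant linear map \<open>v \<mapsto> (\<alpha> \<mapsto> \<Sum>i. \<plusminus> v i t)\<close>. A common zero has vanishing tails,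
  hence unit heads, and would be an equipartition; so normalising yields an equivariant map to the
  sphere. If \<open>d < j\<close>, the linear maps alone give such a map, so the hypothesis forces \<open>j \<le> d\<close>.\<close>

section \<open>Signs and the action on index sets\<close>

definition eps :: "nat set \<Rightarrow> nat \<Rightarrow> real" where
  "eps \<alpha> i = (if i \<in> \<alpha> then 1 else -1)"

lemma eps_actIdx: "eps (actIdx \<beta> \<tau> \<alpha>) i = (if i \<in> \<beta> then -1 else 1) * eps \<alpha> (inv \<tau> i)"
  by (auto simp: eps_def actIdx_def)

text \<open>The sign changes by \<beta> on the index and on the vector cancel, so signed coordinates
  are merely permuted by \<open>inv \<tau>\<close>.\<close>

lemma eps_actIdx_mult_actY:
  "eps (actIdx \<beta> \<tau> \<alpha>) i * actY \<beta> \<tau> v i t = eps \<alpha> (inv \<tau> i) * v (inv \<tau> i) t"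
  by (simp add: eps_actIdx actY_def)

text \<open>An injective self-map of a finite set is bijective. This allows reindexing of sums over
  all orthants.\<close>

lemma bij_betw_actIdx:
  assumes "(\<beta>, \<tau>) \<in> Wk k"
  shows "bij_betw (actIdx \<beta> \<tau>) (Pow {..<k}) (Pow {..<k})"
proof -
  have b: "\<beta> \<subseteq> {..<k}" and t: "\<tau> permutes {..<k}" using assms by (auto simp: Wk_def)
  have sub: "actIdx \<beta> \<tau> ` Pow {..<k} \<subseteq> Pow {..<k}"
  proof safe
    fix \<alpha> i assume a: "\<alpha> \<subseteq> {..<k}" "i \<in> actIdx \<beta> \<tau> \<alpha>"
    show "i < k"
    proof (rule ccontr)
      assume i: "\<not> i < k"
      then have "inv \<tau> i = i" using permutes_inv[OF t] by (simp add: permutes_def)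
      then show False using a b i by (auto simp: actIdx_def)
    qed
  qed
  have "inj (actIdx \<beta> \<tau>)"
  proof (rule injI, rule set_eqI)
    fix \<alpha> \<alpha>' i assume "actIdx \<beta> \<tau> \<alpha> = actIdx \<beta> \<tau> \<alpha>'"
    \<comment> \<open>Membership of \<open>\<tau> i\<close> in the image recovers membership of
      \<open>i\<close> in the argument, up to a flip depending only on \<beta>.\<close>
    then have "\<tau> i \<in> actIdx \<beta> \<tau> \<alpha> \<longleftrightarrow> \<tau> i \<in> actIdx \<beta> \<tau> \<alpha>'" by simp
    then show "i \<in> \<alpha> \<longleftrightarrow> i \<in> \<alpha>'"
      by (auto simp: actIdx_def permutes_inverses[OF t])
  qed
  then have "inj_on (actIdx \<beta> \<tau>) (Pow {..<k})" by (rule inj_on_subset) simp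
  with sub show ?thesis by (simp add: bij_betw_def endo_inj_surj)
qed

lemma continuous_on_coordinate:
  "continuous_on S (\<lambda>v :: nat \<Rightarrow> nat \<Rightarrow> real. v i t)"
  by (rule continuous_on_product_then_coordinatewise[where f="\<lambda>v. v i"],
      rule continuous_on_product_then_coordinatewise[where f="\<lambda>v. v"], rule continuous_on_id)

section \<open>Normalising a nowhere zero equivariant map\<close>

text \<open>The group only permutes coordinates within each copy of U, so the Euclidean norm of
  \<open>F\<close> is invariant and dividing by it preserves equivariance.\<close>

lemma ex_equivariant_to_sphere:
  assumes cont: "\<And>l \<alpha>. l < j \<Longrightarrow> \<alpha> \<subseteq> {..<k} \<Longrightarrow> continuous_on (Yspace d k) (\<lambda>v. F v l \<alpha>)"
    and sum0: "\<And>v l. v \<in> Yspace d k \<Longrightarrow> l < j \<Longrightarrow> (\<Sum>\<alpha>\<in>Pow {..<k}. F v l \<alpha>) = 0"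
    and equiv: "equivariant d k j F"
    and nz: "\<And>v. v \<in> Yspace d k \<Longrightarrow> \<exists>l<j. \<exists>\<alpha>\<subseteq>{..<k}. F v l \<alpha> \<noteq> 0"
  shows "\<exists>f. continuous_on (Yspace d k) f \<and> f ` Yspace d k \<subseteq> SU k j \<and> equivariant d k j f"
proof -
  define N where "N v = (\<Sum>l<j. \<Sum>\<alpha>\<in>Pow {..<k}. (F v l \<alpha>)\<^sup>2)" for v
  \<comment> \<open>\<open>SU\<close> demands zeros outside the index range, where \<open>F\<close>
    is unconstrained.\<close>
  define f where "f v l \<alpha> = (if l < j \<and> \<alpha> \<subseteq> {..<k} then F v l \<alpha> / sqrt (N v) else 0)" for v l \<alpha>
  have Npos: "N v > 0" if v: "v \<in> Yspace d k" for v
  proof -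
    obtain l \<alpha> where l: "l < j" "\<alpha> \<subseteq> {..<k}" "F v l \<alpha> \<noteq> 0" using nz[OF v] by blast
    have "(\<Sum>\<alpha>\<in>Pow {..<k}. (F v l \<alpha>)\<^sup>2) > 0"
      using l by (intro sum_pos2[where i=\<alpha>]) auto
    then show ?thesis unfolding N_def
      using l by (intro sum_pos2[where i=l]) (auto intro: sum_nonneg)
  qed
  have Nact: "N (actY \<beta> \<tau> v) = N v" if g: "(\<beta>, \<tau>) \<in> Wk k" and v: "v \<in> Yspace d k" for \<beta> \<tau> v
    unfolding N_def
  proof (rule sum.cong[OF refl])
    fix l assume "l \<in> {..<j}"
    then have l: "l < j" by simp
    have "(\<Sum>\<alpha>\<in>Pow {..<k}. (F (actY \<beta> \<tau> v) l \<alpha>)\<^sup>2)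
        = (\<Sum>\<alpha>\<in>Pow {..<k}. (F (actY \<beta> \<tau> v) l (actIdx \<beta> \<tau> \<alpha>))\<^sup>2)"
      by (rule sum.reindex_bij_betw[OF bij_betw_actIdx[OF g], symmetric])
    also have "\<dots> = (\<Sum>\<alpha>\<in>Pow {..<k}. (F v l \<alpha>)\<^sup>2)"
      using equiv g v l by (intro sum.cong) (auto simp: equivariant_def)
    finally show "(\<Sum>\<alpha>\<in>Pow {..<k}. (F (actY \<beta> \<tau> v) l \<alpha>)\<^sup>2) = (\<Sum>\<alpha>\<in>Pow {..<k}. (F v l \<alpha>)\<^sup>2)" .
  qed
  have "continuous_on (Yspace d k) f"
  proof (intro continuous_on_coordinatewise_then_product)
    fix l \<alpha>
    have "continuous_on (Yspace d k) N" unfolding N_def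
      by (intro continuous_intros cont) auto
    then have "continuous_on (Yspace d k) (\<lambda>v. F v l \<alpha> / sqrt (N v))" if "l < j" "\<alpha> \<subseteq> {..<k}"
      using that by (intro continuous_intros cont) (auto dest: Npos)
    then show "continuous_on (Yspace d k) (\<lambda>v. f v l \<alpha>)"
      unfolding f_def by (cases "l < j \<and> \<alpha> \<subseteq> {..<k}") (simp_all only: if_True if_False simp_thms continuous_on_const)
  qed
  moreover have "f v \<in> SU k j" if v: "v \<in> Yspace d k" for v
  proof -
    have "(\<Sum>\<alpha>\<in>Pow {..<k}. f v l \<alpha>) = 0" if "l < j" for l
    proof -
      have "(\<Sum>\<alpha>\<in>Pow {..<k}. f v l \<alpha>) = (\<Sum>\<alpha>\<in>Pow {..<k}. F v l \<alpha>) / sqrt (N v)"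
        using that by (simp add: f_def sum_divide_distrib)
      then show ?thesis using sum0[OF v that] by simp
    qed
    moreover have "(\<Sum>l<j. \<Sum>\<alpha>\<in>Pow {..<k}. (f v l \<alpha>)\<^sup>2) = N v / N v"
      using Npos[OF v] by (simp add: f_def N_def[of v, symmetric] power_divide
          flip: sum_divide_distrib)
    ultimately show ?thesis using Npos[OF v] by (auto simp: SU_def f_def)
  qed
  moreover have "equivariant d k j f"
    unfolding equivariant_def
  proof (intro allI impI ballI)
    fix \<beta> \<tau> v l \<alpha>
    assume g: "(\<beta>, \<tau>) \<in> Wk k" and v: "v \<in> Yspace d k" and l: "l < j" and \<alpha>: "\<alpha> \<in> Pow {..<k}"
    have "actIdx \<beta> \<tau> \<alpha> \<in> Pow {..<k}" using bij_betw_apply[OF bij_betw_actIdx[OF g] \<alpha>] .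
    moreover have "F (actY \<beta> \<tau> v) l (actIdx \<beta> \<tau> \<alpha>) = F v l \<alpha>"
      using equiv g v l \<alpha> by (auto simp: equivariant_def)
    ultimately show "f (actY \<beta> \<tau> v) l (actIdx \<beta> \<tau> \<alpha>) = f v l \<alpha>"
      using \<alpha> l Nact[OF g v] by (simp add: f_def)
  qed
  ultimately show ?thesis by blast
qed

section \<open>Linear equivariant maps\<close>

definition signed_sum :: "nat \<Rightarrow> nat \<Rightarrow> (nat \<Rightarrow> nat \<Rightarrow> real) \<Rightarrow> nat set \<Rightarrow> real" where
  "signed_sum k t v \<alpha> = (\<Sum>i<k. eps \<alpha> i * v i t)"

lemma signed_sum_act:
  assumes "(\<beta>, \<tau>) \<in> Wk k"
  shows "signed_sum k t (actY \<beta> \<tau> v) (actIdx \<beta> \<tau> \<alpha>) = signed_sum k t v \<alpha>"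
proof -
  have "inv \<tau> permutes {..<k}" using assms by (auto simp: Wk_def permutes_inv)
  then show ?thesis
    unfolding signed_sum_def eps_actIdx_mult_actY
    by (intro sum.reindex_bij_betw permutes_imp_bij)
qed

text \<open>Complementing \<alpha> reverses every sign, so the total equals its own
  negative.\<close>

lemma sum_signed_sum: "(\<Sum>\<alpha>\<in>Pow {..<k}. signed_sum k t v \<alpha>) = 0"
proof -
  have "(\<Sum>\<alpha>\<in>Pow {..<k}. signed_sum k t v \<alpha>) = (\<Sum>\<alpha>\<in>Pow {..<k}. signed_sum k t v ({..<k} - \<alpha>))"
    by (rule sum.reindex_bij_witness[where i="\<lambda>\<alpha>. {..<k} - \<alpha>" and j="\<lambda>\<alpha>. {..<k} - \<alpha>"])
      (auto simp: double_diff)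
  also have "\<dots> = - (\<Sum>\<alpha>\<in>Pow {..<k}. signed_sum k t v \<alpha>)"
    unfolding signed_sum_def sum_negf[symmetric] by (intro sum.cong) (auto simp: eps_def)
  finally show ?thesis by simp
qed

text \<open>The index sets \<open>{i}\<close> and \<open>{}\<close> differ only in the sign at
  \<open>i\<close>, so their signed sums differ by \<open>2 * v i t\<close>.\<close>

lemma signed_sum_eq_0D:
  assumes "\<And>\<alpha>. \<alpha> \<subseteq> {..<k} \<Longrightarrow> signed_sum k t v \<alpha> = 0" and i: "i < k"
  shows "v i t = 0"
proof -
  have "0 = signed_sum k t v {i} - signed_sum k t v {}" using assms by simp
  also have "\<dots> = (\<Sum>i'<k. if i' = i then 2 * v i' t else 0)"
    unfolding signed_sum_def sum_subtractf[symmetric] by (intro sum.cong) (auto simp: eps_def)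
  also have "\<dots> = 2 * v i t" using i by simp
  finally show ?thesis by simp
qed

lemma continuous_on_signed_sum: "continuous_on S (\<lambda>v. signed_sum k t v \<alpha>)"
  unfolding signed_sum_def by (intro continuous_intros continuous_on_coordinate)

text \<open>There are d + 1 coordinates, and j > d copies of U suffice to record each of them; a
  common zero would make the unit vector \<open>v 0\<close> vanish.\<close>

lemma ex_equivariant_of_less:
  assumes "d < j" "1 \<le> k"
  shows "\<exists>f. continuous_on (Yspace d k) f \<and> f ` Yspace d k \<subseteq> SU k j \<and> equivariant d k j f"
proof (rule ex_equivariant_to_sphere[where F="\<lambda>v l \<alpha>. signed_sum k l v \<alpha>"])
  show "equivariant d k j (\<lambda>v l. signed_sum k l v)"
    by (simp add: equivariant_def signed_sum_act)
  fix v assume v: "v \<in> Yspace d k"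
  show "\<exists>l<j. \<exists>\<alpha>\<subseteq>{..<k}. signed_sum k l v \<alpha> \<noteq> 0"
  proof (rule ccontr)
    assume "\<not> ?thesis"
    then have "v 0 t = 0" if "t \<le> d" for t
      using signed_sum_eq_0D[of k t v 0] that assms by auto
    then have "(\<Sum>t\<le>d. (v 0 t)\<^sup>2) = 0" by simp
    with v assms show False by (auto simp: Yspace_def)
  qed
qed (auto simp: sum_signed_sum continuous_on_signed_sum)

section \<open>Hyperplanes and orthant weights\<close>

text \<open>Entries of \<open>w\<close> beyond \<open>n\<close> are ignored, so a point of the
  larger sphere can be used without truncation: its head is the normal vector followed by the
  constant term.\<close>

definition affine_form :: "nat \<Rightarrow> (nat \<Rightarrow> real) \<Rightarrow> (nat \<Rightarrow> real) \<Rightarrow> real" where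
  "affine_form n w x = (\<Sum>t<n. w t * x t) + w n"

text \<open>Off the hyperplanes \<open>affine_form n (v i) x = 0\<close> this is the indicator function of the orthant
  \<open>\<alpha>\<close>, but it satisfies the summation and equivariance identities for every \<open>x\<close>.\<close>
definition orthant_weight ::
    "nat \<Rightarrow> nat \<Rightarrow> (nat \<Rightarrow> nat \<Rightarrow> real) \<Rightarrow> nat set \<Rightarrow> (nat \<Rightarrow> real) \<Rightarrow> real" where
  "orthant_weight n k v \<alpha> x = (\<Prod>i<k. (1 + eps \<alpha> i * sgn (affine_form n (v i) x)) / 2)"

text \<open>This is the expansion of a product whose factors (1 + s)/2 + (1 - s)/2 are all 1,
  whether or not s = 0.\<close>

lemma sum_orthant_weight: "(\<Sum>\<alpha>\<in>Pow {..<k}. orthant_weight n k v \<alpha> x) = 1"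
proof -
  let ?s = "\<lambda>i. sgn (affine_form n (v i) x)"
  have "(\<Sum>\<alpha>\<in>Pow {..<k}. orthant_weight n k v \<alpha> x) =
      (\<Sum>\<alpha>\<in>Pow {..<k}. (\<Prod>i\<in>\<alpha>. (1 + ?s i) / 2) * (\<Prod>i\<in>{..<k} - \<alpha>. (1 - ?s i) / 2))"
  proof (rule sum.cong[OF refl])
    fix \<alpha> assume "\<alpha> \<in> Pow {..<k}"
    then have "\<alpha> \<subseteq> {..<k}" by simp
    then have "orthant_weight n k v \<alpha> x =
        (\<Prod>i\<in>{..<k} - \<alpha>. (1 + eps \<alpha> i * ?s i) / 2) * (\<Prod>i\<in>\<alpha>. (1 + eps \<alpha> i * ?s i) / 2)"
      unfolding orthant_weight_def by (intro prod.subset_diff) auto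
    also have "\<dots> = (\<Prod>i\<in>{..<k} - \<alpha>. (1 - ?s i) / 2) * (\<Prod>i\<in>\<alpha>. (1 + ?s i) / 2)"
      by (intro arg_cong2[where f="(*)"] prod.cong) (auto simp: eps_def)
    finally show "orthant_weight n k v \<alpha> x =
        (\<Prod>i\<in>\<alpha>. (1 + ?s i) / 2) * (\<Prod>i\<in>{..<k} - \<alpha>. (1 - ?s i) / 2)" by simp
  qed
  also have "\<dots> = (\<Prod>i<k. (1 + ?s i) / 2 + (1 - ?s i) / 2)"
    by (rule prod_add[symmetric]) simp
  also have "\<dots> = 1" by (simp add: field_simps)
  finally show ?thesis .
qed

lemma orthant_weight_bounds: "0 \<le> orthant_weight n k v \<alpha> x" "orthant_weight n k v \<alpha> x \<le> 1"
  unfolding orthant_weight_def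
  by (auto intro!: prod_nonneg prod_le_1 simp: eps_def sgn_if)

text \<open>The affine form is odd in its coefficients, so the signs from \<beta> cancel and the
  factors of the product are permuted.\<close>

lemma orthant_weight_act:
  assumes "(\<beta>, \<tau>) \<in> Wk k"
  shows "orthant_weight n k (actY \<beta> \<tau> v) (actIdx \<beta> \<tau> \<alpha>) x = orthant_weight n k v \<alpha> x"
proof -
  have p: "inv \<tau> permutes {..<k}" using assms by (auto simp: Wk_def permutes_inv)
  have form: "affine_form n (actY \<beta> \<tau> v i) x = (if i \<in> \<beta> then -1 else 1) * affine_form n (v (inv \<tau> i)) x" for i
    by (simp add: affine_form_def actY_def sum_negf)
  have "eps (actIdx \<beta> \<tau> \<alpha>) i * sgn (affine_form n (actY \<beta> \<tau> v i) x) =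
      eps \<alpha> (inv \<tau> i) * sgn (affine_form n (v (inv \<tau> i)) x)" for i
    unfolding form eps_actIdx by (simp add: sgn_minus)
  then show ?thesis
    unfolding orthant_weight_def
    using prod.reindex_bij_betw[OF permutes_imp_bij[OF p],
        of "\<lambda>i. (1 + eps \<alpha> i * sgn (affine_form n (v i) x)) / 2"]
    by simp
qed

text \<open>Each factor is 1 or 0 according to the side of the hyperplane. The offset is
  \<open>- v i n\<close> because the constant term moves across the inequality.\<close>

lemma orthant_weight_eq_indicator:
  assumes "\<And>i. i < k \<Longrightarrow> affine_form n (v i) x \<noteq> 0" and x: "x \<in> space (Rn n)"
  shows "orthant_weight n k v \<alpha> x = indicator (orthant n k v (\<lambda>i. - v i n) \<alpha>) x"
proof -
  have mem: "x \<in> orthant n k v (\<lambda>i. - v i n) \<alpha> \<longleftrightarrow> (\<forall>i<k. eps \<alpha> i * affine_form n (v i) x \<ge> 0)"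
    using x by (auto simp: orthant_def eps_def affine_form_def split: if_splits)
  show ?thesis
  proof (cases "\<forall>i<k. eps \<alpha> i * affine_form n (v i) x \<ge> 0")
    case True
    have "(1 + eps \<alpha> i * sgn (affine_form n (v i) x)) / 2 = 1" if "i < k" for i
      using True[rule_format, OF that] assms(1)[OF that]
      by (auto simp: eps_def sgn_if split: if_splits)
    then show ?thesis using True mem by (simp add: orthant_weight_def)
  next
    case False
    then obtain i where i: "i < k" "eps \<alpha> i * affine_form n (v i) x < 0" by force
    then have "(1 + eps \<alpha> i * sgn (affine_form n (v i) x)) / 2 = 0"
      by (auto simp: eps_def sgn_if split: if_splits)
    then have "orthant_weight n k v \<alpha> x = 0"
      unfolding orthant_weight_def using i by (intro prod_zero) auto
    then show ?thesis using False mem by (simp add: indicator_def)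
  qed
qed

text \<open>With zero normal vector the form is a nonzero constant, a hyperplane at infinity with
  one empty side; \<alpha> selects that side at \<open>i\<close>.\<close>

lemma orthant_weight_degenerate:
  assumes "i < k" "\<And>t. t < n \<Longrightarrow> v i t = 0" "v i n \<noteq> 0"
  shows "\<exists>\<alpha>\<subseteq>{..<k}. \<forall>x. orthant_weight n k v \<alpha> x = 0"
proof (intro exI conjI allI)
  let ?\<alpha> = "if v i n < 0 then {i} else {}"
  show "?\<alpha> \<subseteq> {..<k}" using assms by auto
  fix x
  have "affine_form n (v i) x = v i n" using assms by (simp add: affine_form_def)
  then have "(1 + eps ?\<alpha> i * sgn (affine_form n (v i) x)) / 2 = 0"
    using assms(3) by (simp add: eps_def sgn_if)
  then show "orthant_weight n k v ?\<alpha> x = 0"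
    unfolding orthant_weight_def using assms(1) by (intro prod_zero) auto
qed

section \<open>Integrals of orthant weights\<close>

lemma measurable_affine_form [measurable]: "affine_form n w \<in> borel_measurable (Rn n)"
  unfolding affine_form_def[abs_def] Rn_def by measurable

lemma measurable_orthant_weight:
  assumes "mass n \<mu>"
  shows "orthant_weight n k v \<alpha> \<in> borel_measurable \<mu>"
proof -
  have "orthant_weight n k v \<alpha> \<in> borel_measurable (Rn n)"
    unfolding orthant_weight_def[abs_def] by measurable
  then show ?thesis using assms by (simp add: mass_def cong: measurable_cong_sets)
qed

lemma integrable_orthant_weight:
  assumes "mass n \<mu>"
  shows "integrable \<mu> (orthant_weight n k v \<alpha>)"
proof -
  interpret prob_space \<mu> using assms by (simp add: mass_def)
  show ?thesis
    by (rule integrable_const_bound[where B=1])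
      (use orthant_weight_bounds in \<open>auto simp: measurable_orthant_weight[OF assms] abs_of_nonneg\<close>)
qed

text \<open>Here the hyperplane condition in \<open>mass\<close> enters. If the normal vanishes, the
  form is a nonzero constant instead.\<close>

lemma AE_affine_form_nonzero:
  assumes \<mu>: "mass n \<mu>" and w: "\<exists>t\<le>n. w t \<noteq> 0"
  shows "AE x in \<mu>. affine_form n w x \<noteq> 0"
proof (cases "\<exists>t<n. w t \<noteq> 0")
  case True
  interpret prob_space \<mu> using \<mu> by (simp add: mass_def)
  have sp: "space \<mu> = space (Rn n)" and se: "sets \<mu> = sets (Rn n)"
    using \<mu> sets_eq_imp_space_eq[of \<mu> "Rn n"] by (auto simp: mass_def)
  let ?H = "{x \<in> space (Rn n). affine_form n w x = 0}"
  have "?H = {x \<in> space (Rn n). (\<Sum>t<n. w t * x t) = - w n}"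
    by (auto simp: affine_form_def)
  then have "measure \<mu> ?H = 0" using \<mu> True by (simp add: mass_def)
  moreover have "?H \<in> sets \<mu>" unfolding se by measurable
  ultimately have "?H \<in> null_sets \<mu>" by (simp add: null_sets_def emeasure_eq_measure)
  then show ?thesis by (rule AE_I') (auto simp: sp)
next
  case False
  with w have "w n \<noteq> 0" by (metis le_neq_implies_less)
  with False show ?thesis by (simp add: affine_form_def)
qed

text \<open>Almost every point avoids the hyperplanes of the limit \<open>v\<close>, and there
  \<open>sgn\<close> is continuous; dominated convergence with bound 1 does the rest. Only the limit
  needs nonzero heads.\<close>

lemma isCont_integral_orthant_weight:
  assumes \<mu>: "mass n \<mu>" and v: "\<And>i. i < k \<Longrightarrow> \<exists>t\<le>n. v i t \<noteq> 0"
  shows "isCont (\<lambda>v. \<integral>x. orthant_weight n k v \<alpha> x \<partial>\<mu>) v"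
proof (rule continuous_within_sequentiallyI)
  fix u :: "nat \<Rightarrow> nat \<Rightarrow> nat \<Rightarrow> real" assume u: "u \<longlonglongrightarrow> v"
  interpret prob_space \<mu> using \<mu> by (simp add: mass_def)
  have coord: "(\<lambda>q. u q i t) \<longlonglongrightarrow> v i t" for i t
    using continuous_on_tendsto_compose[OF continuous_on_coordinate[of UNIV i t] u] by simp
  have "AE x in \<mu>. \<forall>i\<in>{..<k}. affine_form n (v i) x \<noteq> 0"
    by (rule AE_finite_allI) (use AE_affine_form_nonzero[OF \<mu>] v in auto)
  then have "AE x in \<mu>. (\<lambda>q. orthant_weight n k (u q) \<alpha> x) \<longlonglongrightarrow> orthant_weight n k v \<alpha> x"
  proof eventually_elim
    case (elim x)
    have "(\<lambda>q. affine_form n (u q i) x) \<longlonglongrightarrow> affine_form n (v i) x" for i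
      unfolding affine_form_def by (intro tendsto_intros coord)
    then show ?case
      unfolding orthant_weight_def using elim by (intro tendsto_intros) auto
  qed
  then show "(\<lambda>q. \<integral>x. orthant_weight n k (u q) \<alpha> x \<partial>\<mu>) \<longlonglongrightarrow> (\<integral>x. orthant_weight n k v \<alpha> x \<partial>\<mu>)"
    by (rule integral_dominated_convergence[where w="\<lambda>_. 1", rotated 3])
      (use orthant_weight_bounds in \<open>auto simp: measurable_orthant_weight[OF \<mu>] abs_of_nonneg\<close>)
qed

text \<open>Weight and indicator can differ only on the finitely many hyperplanes, a null set, so
  overlapping boundaries of closed orthants do not matter.\<close>

lemma measure_orthant:
  assumes \<mu>: "mass n \<mu>" and v: "\<And>i. i < k \<Longrightarrow> \<exists>t<n. v i t \<noteq> 0"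
  shows "measure \<mu> (orthant n k v (\<lambda>i. - v i n) \<alpha>) = (\<integral>x. orthant_weight n k v \<alpha> x \<partial>\<mu>)"
proof -
  interpret prob_space \<mu> using \<mu> by (simp add: mass_def)
  let ?O = "orthant n k v (\<lambda>i. - v i n) \<alpha>"
  have sp: "space \<mu> = space (Rn n)" and se: "sets \<mu> = sets (Rn n)"
    using \<mu> sets_eq_imp_space_eq[of \<mu> "Rn n"] by (auto simp: mass_def)
  have "?O = {x \<in> space (Rn n). \<forall>i\<in>{..<k}. 0 \<le> eps \<alpha> i * affine_form n (v i) x}"
    by (auto simp: orthant_def eps_def affine_form_def field_simps split: if_splits)
  also have "\<dots> \<in> sets \<mu>" unfolding se by measurable
  finally have O: "?O \<in> sets \<mu>" .
  have "AE x in \<mu>. \<forall>i\<in>{..<k}. affine_form n (v i) x \<noteq> 0"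
  proof (rule AE_finite_allI)
    fix i assume "i \<in> {..<k}"
    then have "\<exists>t\<le>n. v i t \<noteq> 0" using v by (meson lessThan_iff less_imp_le)
    then show "AE x in \<mu>. affine_form n (v i) x \<noteq> 0" by (rule AE_affine_form_nonzero[OF \<mu>])
  qed simp
  then have "AE x in \<mu>. orthant_weight n k v \<alpha> x = indicator ?O x"
    using AE_space
    by eventually_elim (auto simp: sp intro!: orthant_weight_eq_indicator)
  then have "(\<integral>x. orthant_weight n k v \<alpha> x \<partial>\<mu>) = (\<integral>x. indicator ?O x \<partial>\<mu>)"
    using O by (intro integral_cong_AE) (auto simp: measurable_orthant_weight[OF \<mu>])
  then show ?thesis using O by simp
qed

section \<open>Extending the defects over vanishing heads\<close>

text \<open>An invariant continuous damping factor, zero exactly when some head vanishes.\<close>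

definition head_factor :: "nat \<Rightarrow> nat \<Rightarrow> (nat \<Rightarrow> nat \<Rightarrow> real) \<Rightarrow> real" where
  "head_factor n k v = (\<Prod>i<k. \<Sum>t\<le>n. (v i t)\<^sup>2)"

lemma head_factor_act:
  assumes "(\<beta>, \<tau>) \<in> Wk k"
  shows "head_factor n k (actY \<beta> \<tau> v) = head_factor n k v"
proof -
  have p: "inv \<tau> permutes {..<k}" using assms by (auto simp: Wk_def permutes_inv)
  have "(actY \<beta> \<tau> v i t)\<^sup>2 = (v (inv \<tau> i) t)\<^sup>2" for i t
    by (simp add: actY_def)
  then show ?thesis
    unfolding head_factor_def
    using prod.reindex_bij_betw[OF permutes_imp_bij[OF p], of "\<lambda>i. \<Sum>t\<le>n. (v i t)\<^sup>2"] by simp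
qed

definition orthant_defect ::
    "nat \<Rightarrow> nat \<Rightarrow> (nat \<Rightarrow> real) measure \<Rightarrow> (nat \<Rightarrow> nat \<Rightarrow> real) \<Rightarrow> nat set \<Rightarrow> real" where
  "orthant_defect n k \<mu> v \<alpha> = (\<integral>x. orthant_weight n k v \<alpha> x \<partial>\<mu>) - 1 / 2 ^ k"

lemma abs_orthant_defect_le:
  assumes \<mu>: "mass n \<mu>"
  shows "\<bar>orthant_defect n k \<mu> v \<alpha>\<bar> \<le> 1"
proof -
  interpret prob_space \<mu> using \<mu> by (simp add: mass_def)
  have "0 \<le> (\<integral>x. orthant_weight n k v \<alpha> x \<partial>\<mu>)"
    by (simp add: orthant_weight_bounds)
  moreover have "(\<integral>x. orthant_weight n k v \<alpha> x \<partial>\<mu>) \<le> 1"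
    using integral_le_const[OF integrable_orthant_weight[OF \<mu>]] orthant_weight_bounds by simp
  moreover have "0 \<le> (1 / 2 ^ k :: real)" "(1 / 2 ^ k :: real) \<le> 1" by auto
  ultimately show ?thesis unfolding orthant_defect_def by linarith
qed

text \<open>The weights sum to 1 and there are \<open>2 ^ k\<close> index sets, so the defects lie
  in U.\<close>

lemma sum_orthant_defect:
  assumes \<mu>: "mass n \<mu>"
  shows "(\<Sum>\<alpha>\<in>Pow {..<k}. orthant_defect n k \<mu> v \<alpha>) = 0"
proof -
  interpret prob_space \<mu> using \<mu> by (simp add: mass_def)
  have "(\<Sum>\<alpha>\<in>Pow {..<k}. \<integral>x. orthant_weight n k v \<alpha> x \<partial>\<mu>)
      = (\<integral>x. (\<Sum>\<alpha>\<in>Pow {..<k}. orthant_weight n k v \<alpha> x) \<partial>\<mu>)"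
    by (intro Bochner_Integration.integral_sum[symmetric] integrable_orthant_weight \<mu>)
  also have "\<dots> = 1" by (simp add: sum_orthant_weight prob_space)
  finally show ?thesis
    by (simp add: orthant_defect_def sum_subtractf card_Pow)
qed

text \<open>Where the factor is nonzero, both factors are continuous. Where it vanishes, the defect
  may jump, but being bounded it is squeezed to 0.\<close>

lemma continuous_on_head_factor_mult_defect:
  assumes \<mu>: "mass n \<mu>"
  shows "continuous_on S (\<lambda>v. head_factor n k v * orthant_defect n k \<mu> v \<alpha>)"
proof (rule continuous_at_imp_continuous_on, rule ballI)
  fix v
  have "continuous_on UNIV (head_factor n k)"
    unfolding head_factor_def[abs_def] by (intro continuous_intros continuous_on_coordinate)
  then have hf: "isCont (head_factor n k) v" by (simp add: continuous_on_eq_continuous_at)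
  show "isCont (\<lambda>v. head_factor n k v * orthant_defect n k \<mu> v \<alpha>) v"
  proof (cases "head_factor n k v = 0")
    case True
    then have "head_factor n k \<midarrow>v\<rightarrow> 0" using hf by (simp add: isCont_def)
    then have lim: "(\<lambda>u. \<bar>head_factor n k u\<bar>) \<midarrow>v\<rightarrow> 0" by (rule tendsto_rabs_zero)
    have "\<bar>head_factor n k u * orthant_defect n k \<mu> u \<alpha>\<bar> \<le> \<bar>head_factor n k u\<bar>" for u
      using mult_left_mono[OF abs_orthant_defect_le[OF \<mu>] abs_ge_zero] by (simp add: abs_mult)
    then have "(\<lambda>u. head_factor n k u * orthant_defect n k \<mu> u \<alpha>) \<midarrow>v\<rightarrow> 0"
      by (intro Lim_null_comparison[OF _ lim] always_eventually) auto
    then show ?thesis using True by (simp add: isCont_def)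
  next
    case False
    have "\<exists>t\<le>n. v i t \<noteq> 0" if "i < k" for i
    proof (rule ccontr)
      assume "\<not> ?thesis"
      then have "(\<Sum>t\<le>n. (v i t)\<^sup>2) = 0" by simp
      with that have "head_factor n k v = 0"
        unfolding head_factor_def by (intro prod_zero) auto
      with False show False by simp
    qed
    then show ?thesis
      unfolding orthant_defect_def
      by (intro continuous_intros hf isCont_integral_orthant_weight \<mu>) auto
  qed
qed

section \<open>The test map of a counterexample\<close>

lemma equipartitionable_if_no_equivariant:
  assumes k: "1 \<le> k" and m: "m < j" "m \<le> d"
    and no: "\<not> (\<exists>f. continuous_on (Yspace d k) f \<and> f ` Yspace d k \<subseteq> SU k j \<and> equivariant d k j f)"
  shows "equipartitionable (j - m) k (d - m)"
proof (rule ccontr)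
  assume "\<not> ?thesis"
  then obtain \<mu> :: "nat \<Rightarrow> (nat \<Rightarrow> real) measure" where
    \<mu>: "\<forall>l<j - m. mass (d - m) (\<mu> l)"
    and noeq: "\<not> (\<exists>a b. (\<forall>i<k. \<exists>t<d - m. a i t \<noteq> 0) \<and>
      (\<forall>l<j - m. \<forall>\<alpha>. \<alpha> \<subseteq> {..<k} \<longrightarrow> measure (\<mu> l) (orthant (d - m) k a b \<alpha>) = 1 / 2 ^ k))"
    unfolding equipartitionable_def not_all not_imp by (elim exE conjE)
  define n where "n = d - m"
  \<comment> \<open>The first \<open>j - m\<close> copies of U carry the defects, the last
    \<open>m\<close> the tail coordinates \<open>n + 1\<close>, ..., \<open>d\<close>; there are
    exactly \<open>m\<close> of these as \<open>m \<le> d\<close>.\<close>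
  define F where "F v l \<alpha> = (if l < j - m then head_factor n k v * orthant_defect n k (\<mu> l) v \<alpha>
      else signed_sum k (n + 1 + (l - (j - m))) v \<alpha>)" for v l \<alpha>
  have mass: "mass n (\<mu> l)" if "l < j - m" for l using \<mu> that by (simp add: n_def)
  have "\<exists>f. continuous_on (Yspace d k) f \<and> f ` Yspace d k \<subseteq> SU k j \<and> equivariant d k j f"
  proof (rule ex_equivariant_to_sphere[where F=F])
    show "continuous_on (Yspace d k) (\<lambda>v. F v l \<alpha>)" for l \<alpha>
      by (cases "l < j - m")
        (simp_all add: F_def mass continuous_on_head_factor_mult_defect continuous_on_signed_sum)
    show "(\<Sum>\<alpha>\<in>Pow {..<k}. F v l \<alpha>) = 0" for v l
      by (cases "l < j - m")
        (simp_all add: F_def mass sum_orthant_defect sum_signed_sum flip: sum_distrib_left)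
    show "equivariant d k j F"
      by (simp add: equivariant_def F_def orthant_defect_def signed_sum_act orthant_weight_act
          head_factor_act)
  next
    fix v assume v: "v \<in> Yspace d k"
    show "\<exists>l<j. \<exists>\<alpha>\<subseteq>{..<k}. F v l \<alpha> \<noteq> 0"
    proof (rule ccontr)
      assume "\<not> ?thesis"
      then have F0: "F v l \<alpha> = 0" if "l < j" "\<alpha> \<subseteq> {..<k}" for l \<alpha> using that by blast
      have tail: "v i t = 0" if "i < k" "n < t" "t \<le> d" for i t
      proof (rule signed_sum_eq_0D[OF _ \<open>i < k\<close>])
        fix \<alpha> assume "\<alpha> \<subseteq> {..<k}"
        \<comment> \<open>This inverts the index shift in \<open>F\<close>, giving the copy that
          carries coordinate \<open>t\<close>.\<close>
        moreover define l where "l = j - m + (t - n - 1)"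
        moreover have "l < j" using that m by (simp add: l_def n_def)
        ultimately have "F v l \<alpha> = 0" by (intro F0)
        moreover have "n + 1 + (l - (j - m)) = t" "\<not> l < j - m" using that by (auto simp: l_def)
        ultimately show "signed_sum k t v \<alpha> = 0" by (simp add: F_def)
      qed
      have unit: "(\<Sum>t\<le>n. (v i t)\<^sup>2) = 1" if "i < k" for i
      proof -
        have "(\<Sum>t\<le>n. (v i t)\<^sup>2) = (\<Sum>t\<le>d. (v i t)\<^sup>2)"
          by (rule sum.mono_neutral_left) (use tail that in \<open>auto simp: n_def\<close>)
        then show ?thesis using v that by (simp add: Yspace_def)
      qed
      \<comment> \<open>With unit heads the damping is invisible, so zeros of \<open>F\<close> are
        true zeros of the defects.\<close>
      then have "head_factor n k v = 1" by (simp add: head_factor_def)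
      then have eq: "(\<integral>x. orthant_weight n k v \<alpha> x \<partial>\<mu> l) = 1 / 2 ^ k"
        if "l < j - m" "\<alpha> \<subseteq> {..<k}" for l \<alpha>
        using F0[of l \<alpha>] that by (simp add: F_def orthant_defect_def)
      have nondeg: "\<exists>t<n. v i t \<noteq> 0" if i: "i < k" for i
      proof (rule ccontr)
        assume "\<not> ?thesis"
        then have z: "v i t = 0" if "t < n" for t using that by blast
        \<comment> \<open>A unit head with zero normal has a nonzero constant term.\<close>
        have "v i n \<noteq> 0"
        proof
          assume "v i n = 0"
          then have "(\<Sum>t\<le>n. (v i t)\<^sup>2) = 0" using z by (intro sum.neutral) (auto simp: le_less)
          with unit[OF i] show False by simp
        qed
        then obtain \<alpha> where "\<alpha> \<subseteq> {..<k}" "\<And>x. orthant_weight n k v \<alpha> x = 0"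
          using orthant_weight_degenerate[of i k n v] i z by blast
        \<comment> \<open>Since \<open>m < j\<close> there is a mass with index 0; it would give
          weight 0 instead of \<open>1 / 2 ^ k\<close> to this orthant.\<close>
        with eq[of 0 \<alpha>] m show False by simp
      qed
      have "measure (\<mu> l) (orthant n k v (\<lambda>i. - v i n) \<alpha>) = 1 / 2 ^ k"
        if "l < j - m" "\<alpha> \<subseteq> {..<k}" for l \<alpha>
        using measure_orthant[OF mass nondeg] eq that by simp
      then show False
        using noeq nondeg unfolding n_def[symmetric] by blast
    qed
  qed
  with no show False by blast
qed

theorem theorem3p4:
  fixes d k j :: nat
  assumes "d \<ge> 1" and "k \<ge> 1" and "j \<ge> 1"
    and "\<not> (\<exists>f. continuous_on (Yspace d k) f \<and> f ` Yspace d k \<subseteq> SU k j \<and> equivariant d k j f)"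
  shows "\<forall>m<j. (\<exists>n. equipartitionable (j - m) k n) \<and> int (Delta (j - m) k) \<le> int d - int m"
proof (intro allI impI)
  fix m assume m: "m < j"
  \<comment> \<open>This makes the natural subtraction \<open>d - m\<close> exact, as the integer
    bound requires.\<close>
  have "j \<le> d" using ex_equivariant_of_less[of d j k] assms by (meson not_le)
  with m have "m \<le> d" by simp
  then have e: "equipartitionable (j - m) k (d - m)"
    using equipartitionable_if_no_equivariant assms m by blast
  then have "Delta (j - m) k \<le> d - m" unfolding Delta_def by (rule Least_le)
  with e \<open>m \<le> d\<close> show "(\<exists>n. equipartitionable (j - m) k n) \<and> int (Delta (j - m) k) \<le> int d - int m"
    by (auto simp: of_nat_diff)
qed

end
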